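(* Let $I$ be a non-empty set, $E$ a linear subspace of $\mathbb{R}^I$ with an absolute norm, and $(X_i)_{i\in I}$ a family of Banach spaces which are all locally octahedral (respectively, all locally almost square (LASQ)). Then their absolute sum $X=[\oplus_{i\in I}X_i]_E$ is locally octahedral (respectively, LASQ).
   Context: All Banach spaces are real. $S_X$ and $B_X$ denote the unit sphere and closed unit ball of $X$. A Banach space $X$ is locally almost square (LASQ) if for every $x\in S_X$ there exists a sequence $(y_n)\subset B_X$ such that $\|x\pm y_n\|\to 1$ and $\|y_n\|\to 1$. $X$ is locally octahedral if for every $x\in S_X$ and every $\varepsilon>0$ there exists $y\in S_X$ such that $\|x\pm y\|\ge 2-\varepsilon$. Let $I$ be a non-empty set and $E$ a linear subspace of $\mathbb{R}^I$. An absolute norm on $E$ is a complete norm $\|\cdot\|_E$ on $E$ such that: (i) given $(a_i)_{i\in I},(b_i)_{i\in I}\in\mathbb{R}^I$ with $|b_i|\le|a_i|$ for every $i\in I$, if $(a_i)_{i\in I}\in E$ then $(b_i)_{i\in I}\in E$ and $\|(b_i)_{i\in I}\|_E\le\|(a_i)_{i\in I}\|_E$; (ii) for every $i\in I$ the function $e_i:I\to\mathbb{R}$, $e_i(j)=\delta_{ij}$, belongs to $E$ and $\|e_i\|_E=1$. The absolute sum of a family $(X_i)_{i\in I}$ of Banach spaces with respect to $E$ is $[\oplus_{i\in I}X_i]_E=\{(x_i)_{i\in I}\in\prod_{i\in I}X_i : (\|x_i\|)_{i\in I}\in E\}$, a Banach space with norm $\|(x_i)_{i\in I}\|=\|(\|x_i\|)_{i\in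 I}\|_E$. *)

theory Defs
  imports "HOL-Analysis.Analysis" "HOL-Algebra.Module"
begin

section \<open>Real Banach spaces with explicit carriers\<close>

text \<open>
  A family of Banach spaces and its absolute sum cannot in general be represented by types of class
  \<open>banach\<close>, as the norm and the vector space operations depend on the index and on the given sequence
  space. Normed spaces are therefore records that extend the modules of HOL-Algebra, the scalars
  being the ring of all real numbers. Since \<open>module\<close> inherits from \<open>ring\<close>, the record also has the
  fields \<open>mult\<close> and \<open>one\<close>; these carry no meaning for a module and are left unspecified.
\<close>

definition real_ring :: "real ring"
  where "real_ring = \<lparr>carrier = UNIV, mult = (*), one = 1, zero = 0, add = (+)\<rparr>"

lemma cring_real_ring: "cring real_ring"
proof -
  have "\<exists>y. x + y = 0" for x :: real
    by (rule exI [of _ "- x"]) simp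
  then show ?thesis
    unfolding real_ring_def
    by unfold_locales (auto simp: algebra_simps Units_def)
qed

lemma real_ring_simps [simp]:
  "carrier real_ring = UNIV" "x \<otimes>\<^bsub>real_ring\<^esub> y = x * y" "\<one>\<^bsub>real_ring\<^esub> = 1"
  "x \<oplus>\<^bsub>real_ring\<^esub> y = x + y" "\<zero>\<^bsub>real_ring\<^esub> = 0"
  by (simp_all add: real_ring_def)

lemma real_ring_uminus [simp]: "\<ominus>\<^bsub>real_ring\<^esub> x = - x"
proof -
  interpret cring real_ring by (rule cring_real_ring)
  show ?thesis by (rule minus_equality) auto
qed

record 'a normed = "(real, 'a) module" +
  vnorm :: "'a \<Rightarrow> real"

locale normed_space = module real_ring V for V :: "('a, 'b) normed_scheme" (structure) +
  assumes vnorm_nonneg: "x \<in> carrier V \<Longrightarrow> 0 \<le> vnorm V x"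
    and vnorm_eq_0_iff: "x \<in> carrier V \<Longrightarrow> vnorm V x = 0 \<longleftrightarrow> x = \<zero>\<^bsub>V\<^esub>"
    and vnorm_smult: "x \<in> carrier V \<Longrightarrow> vnorm V (c \<odot>\<^bsub>V\<^esub> x) = \<bar>c\<bar> * vnorm V x"
    and vnorm_triangle: "\<lbrakk>x \<in> carrier V; y \<in> carrier V\<rbrakk> \<Longrightarrow>
          vnorm V (x \<oplus>\<^bsub>V\<^esub> y) \<le> vnorm V x + vnorm V y"

text \<open>
  The locale \<open>Metric_space\<close> asks for nonnegativity and symmetry also outside of the carrier, hence
  the case distinction.
\<close>

definition vdist :: "('a, 'b) normed_scheme \<Rightarrow> 'a \<Rightarrow> 'a \<Rightarrow> real"
  where "vdist V x y =
    (if x \<in> carrier V \<and> y \<in> carrier V then vnorm V (x \<ominus>\<^bsub>V\<^esub> y) else 0)"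

context normed_space
begin

lemma vnorm_zero: "vnorm V \<zero>\<^bsub>V\<^esub> = 0"
  by (simp add: vnorm_eq_0_iff)

lemma vnorm_minus_commute:
  assumes "x \<in> carrier V" "y \<in> carrier V"
  shows "vnorm V (x \<ominus>\<^bsub>V\<^esub> y) = vnorm V (y \<ominus>\<^bsub>V\<^esub> x)"
proof -
  have *: "(-1) \<odot>\<^bsub>V\<^esub> (x \<ominus>\<^bsub>V\<^esub> y) = \<ominus>\<^bsub>V\<^esub> (1 \<odot>\<^bsub>V\<^esub> (x \<ominus>\<^bsub>V\<^esub> y))"
    using smult_l_minus [of 1 "x \<ominus>\<^bsub>V\<^esub> y"] assms by simp
  have "1 \<odot>\<^bsub>V\<^esub> (x \<ominus>\<^bsub>V\<^esub> y) = x \<ominus>\<^bsub>V\<^esub> y"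
    using smult_one [of "x \<ominus>\<^bsub>V\<^esub> y"] assms by simp
  moreover have "\<ominus>\<^bsub>V\<^esub> (x \<ominus>\<^bsub>V\<^esub> y) = y \<ominus>\<^bsub>V\<^esub> x"
    using assms by (simp add: M.minus_add M.minus_minus a_minus_def M.a_comm)
  ultimately show ?thesis
    using * vnorm_smult [of "x \<ominus>\<^bsub>V\<^esub> y" "-1"] assms by simp
qed

lemma vnorm_minus_triangle:
  assumes "x \<in> carrier V" "y \<in> carrier V" "z \<in> carrier V"
  shows "vnorm V (x \<ominus>\<^bsub>V\<^esub> z) \<le> vnorm V (x \<ominus>\<^bsub>V\<^esub> y) + vnorm V (y \<ominus>\<^bsub>V\<^esub> z)"
proof -
  have "(x \<ominus>\<^bsub>V\<^esub> y) \<oplus>\<^bsub>V\<^esub> (y \<ominus>\<^bsub>V\<^esub> z) = x \<oplus>\<^bsub>V\<^esub> (\<ominus>\<^bsub>V\<^esub> y \<oplus>\<^bsub>V\<^esub> (y \<oplus>\<^bsub>V\<^esub> (\<ominus>\<^bsub>V\<^esub> z)))"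
    using assms by (simp add: a_minus_def M.a_assoc)
  also have "\<dots> = x \<ominus>\<^bsub>V\<^esub> z"
    using assms M.r_neg1 [of y "\<ominus>\<^bsub>V\<^esub> z"] by (simp add: a_minus_def)
  finally show ?thesis
    using vnorm_triangle [of "x \<ominus>\<^bsub>V\<^esub> y" "y \<ominus>\<^bsub>V\<^esub> z"] assms by simp
qed

lemma minus_eq_zero_iff:
  assumes "x \<in> carrier V" "y \<in> carrier V"
  shows "x \<ominus>\<^bsub>V\<^esub> y = \<zero>\<^bsub>V\<^esub> \<longleftrightarrow> x = y"
  using assms by (metis M.minus_equality M.minus_minus M.r_neg M.a_inv_closed a_minus_def)

sublocale metric: Metric_space "carrier V" "vdist V"
proof
  show "vdist V x y = vdist V y x" for x y
    by (simp add: vdist_def vnorm_minus_commute)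
qed (auto simp: vdist_def vnorm_nonneg vnorm_eq_0_iff minus_eq_zero_iff vnorm_minus_triangle)

lemma MCauchy_iff:
  "metric.MCauchy \<sigma> \<longleftrightarrow> (\<forall>n. \<sigma> n \<in> carrier V) \<and>
     (\<forall>\<epsilon>>0. \<exists>N. \<forall>m\<ge>N. \<forall>n\<ge>N. vnorm V (\<sigma> m \<ominus>\<^bsub>V\<^esub> \<sigma> n) < \<epsilon>)"
  unfolding metric.MCauchy_def vdist_def image_subset_iff by auto

lemma limit_iff:
  assumes "\<And>n. \<sigma> n \<in> carrier V"
  shows "limitin metric.mtopology \<sigma> l sequentially \<longleftrightarrow>
           l \<in> carrier V \<and> (\<lambda>n. vnorm V (\<sigma> n \<ominus>\<^bsub>V\<^esub> l)) \<longlonglongrightarrow> 0"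
  using assms unfolding metric.limitin_metric_dist_null
  by (auto simp: vdist_def)

lemma mcomplete_iff:
  "metric.mcomplete \<longleftrightarrow>
     (\<forall>\<sigma>. (\<forall>n. \<sigma> n \<in> carrier V) \<and>
        (\<forall>\<epsilon>>0. \<exists>N. \<forall>m\<ge>N. \<forall>n\<ge>N. vnorm V (\<sigma> m \<ominus>\<^bsub>V\<^esub> \<sigma> n) < \<epsilon>) \<longrightarrow>
      (\<exists>l\<in>carrier V. (\<lambda>n. vnorm V (\<sigma> n \<ominus>\<^bsub>V\<^esub> l)) \<longlonglongrightarrow> 0))"
  unfolding metric.mcomplete_def MCauchy_iff
  by (intro iff_allI imp_cong refl) (simp add: limit_iff Bex_def)

end

locale banach_space = normed_space +
  assumes complete: "Metric_space.mcomplete (carrier V) (vdist V)"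

definition unit_sphere :: "('a, 'b) normed_scheme \<Rightarrow> 'a set"
  where "unit_sphere V = {x \<in> carrier V. vnorm V x = 1}"

definition unit_ball :: "('a, 'b) normed_scheme \<Rightarrow> 'a set"
  where "unit_ball V = {x \<in> carrier V. vnorm V x \<le> 1}"

definition locally_almost_square :: "('a, 'b) normed_scheme \<Rightarrow> bool"
  where "locally_almost_square V \<longleftrightarrow>
    (\<forall>x \<in> unit_sphere V. \<exists>y :: nat \<Rightarrow> 'a. (\<forall>n. y n \<in> unit_ball V) \<and>
      (\<lambda>n. vnorm V (x \<oplus>\<^bsub>V\<^esub> y n)) \<longlonglongrightarrow> 1 \<and>
      (\<lambda>n. vnorm V (x \<ominus>\<^bsub>V\<^esub> y n)) \<longlonglongrightarrow> 1 \<and>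
      (\<lambda>n. vnorm V (y n)) \<longlonglongrightarrow> 1)"

definition locally_octahedral :: "('a, 'b) normed_scheme \<Rightarrow> bool"
  where "locally_octahedral V \<longleftrightarrow>
    (\<forall>x \<in> unit_sphere V. \<forall>\<epsilon>>0. \<exists>y \<in> unit_sphere V.
      vnorm V (x \<oplus>\<^bsub>V\<^esub> y) \<ge> 2 - \<epsilon> \<and> vnorm V (x \<ominus>\<^bsub>V\<^esub> y) \<ge> 2 - \<epsilon>)"


section \<open>Absolute norms and absolute sums\<close>

text \<open>
  The index set is the universe of the type \<open>'i\<close>, which is never empty. The members of a family
  \<open>X :: 'i \<Rightarrow> 'a normed\<close> share the type \<open>'a\<close> only as an ambient type: carrier, operations and norm
  all depend on the index.
\<close>

definition function_space :: "('i \<Rightarrow> real) set \<Rightarrow> (('i \<Rightarrow> real) \<Rightarrow> real) \<Rightarrow> ('i \<Rightarrow> real) normed"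
  where "function_space E N =
    \<lparr>carrier = E, mult = undefined, one = undefined, zero = (\<lambda>i. 0), add = (\<lambda>a b i. a i + b i),
     smult = (\<lambda>c a i. c * a i), vnorm = N\<rparr>"

text \<open>
  As the operations of \<open>function_space E N\<close> are the pointwise ones, \<open>banach_space\<close> says that \<open>E\<close> is a
  linear subspace of the space of all functions and that \<open>N\<close> is a complete norm on \<open>E\<close>.
\<close>

locale absolute_norm = banach_space "function_space E N"
  for E :: "('i \<Rightarrow> real) set" and N :: "('i \<Rightarrow> real) \<Rightarrow> real" +
  assumes solid: "\<And>a b. \<lbrakk>\<And>i. \<bar>b i\<bar> \<le> \<bar>a i\<bar>; a \<in> E\<rbrakk> \<Longrightarrow> b \<in> E \<and> N b \<le> N a"
    and unit_vector: "\<And>i. (\<lambda>j. if j = i then 1 else 0) \<in> E \<and> N (\<lambda>j. if j = i then 1 else 0) = 1"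

definition absolute_sum ::
    "('i \<Rightarrow> real) set \<Rightarrow> (('i \<Rightarrow> real) \<Rightarrow> real) \<Rightarrow> ('i \<Rightarrow> 'a normed) \<Rightarrow> ('i \<Rightarrow> 'a) normed"
  where "absolute_sum E N X =
    \<lparr>carrier = {x. (\<forall>i. x i \<in> carrier (X i)) \<and> (\<lambda>i. vnorm (X i) (x i)) \<in> E},
     mult = undefined, one = undefined,
     zero = (\<lambda>i. \<zero>\<^bsub>X i\<^esub>),
     add = (\<lambda>x y i. x i \<oplus>\<^bsub>X i\<^esub> y i),
     smult = (\<lambda>c x i. c \<odot>\<^bsub>X i\<^esub> x i),
     vnorm = (\<lambda>x. N (\<lambda>i. vnorm (X i) (x i)))\<rparr>"



lemma absolute_sum_sel [simp]:
  "carrier (absolute_sum E N X) = {x. (\<forall>i. x i \<in> carrier (X i)) \<and> (\<lambda>i. vnorm (X i) (x i)) \<in> E}"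
  "\<zero>\<^bsub>absolute_sum E N X\<^esub> = (\<lambda>i. \<zero>\<^bsub>X i\<^esub>)"
  "x \<oplus>\<^bsub>absolute_sum E N X\<^esub> y = (\<lambda>i. x i \<oplus>\<^bsub>X i\<^esub> y i)"
  "c \<odot>\<^bsub>absolute_sum E N X\<^esub> x = (\<lambda>i. c \<odot>\<^bsub>X i\<^esub> x i)"
  "vnorm (absolute_sum E N X) x = N (\<lambda>i. vnorm (X i) (x i))"
  by (simp_all add: absolute_sum_def)

lemma function_space_sel [simp]:
  "carrier (function_space E N) = E"
  "\<zero>\<^bsub>function_space E N\<^esub> = (\<lambda>i. 0)"
  "a \<oplus>\<^bsub>function_space E N\<^esub> b = (\<lambda>i. a i + b i)"
  "c \<odot>\<^bsub>function_space E N\<^esub> a = (\<lambda>i. c * a i)"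
  "vnorm (function_space E N) = N"
  by (simp_all add: function_space_def)

context absolute_norm
begin

lemma E_zero: "(\<lambda>i. 0) \<in> E"
  using M.zero_closed by simp

lemma E_add: "a \<in> E \<Longrightarrow> b \<in> E \<Longrightarrow> (\<lambda>i. a i + b i) \<in> E"
  using M.a_closed by simp

lemma E_scale: "a \<in> E \<Longrightarrow> (\<lambda>i. c * a i) \<in> E"
  using smult_closed [of c a] by simp

lemma E_minus: "a \<in> E \<Longrightarrow> b \<in> E \<Longrightarrow> (\<lambda>i. a i - b i) \<in> E"
  using E_add [of a "\<lambda>i. (-1) * b i"] E_scale [of b "-1"] by simp

lemma function_space_minus:
  assumes "a \<in> E" "b \<in> E"
  shows "a \<ominus>\<^bsub>function_space E N\<^esub> b = (\<lambda>i. a i - b i)"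
proof -
  have "\<ominus>\<^bsub>function_space E N\<^esub> b = (\<lambda>i. - b i)"
    using assms E_scale [of b "-1"] by (intro M.minus_equality) auto
  then show ?thesis by (simp add: a_minus_def)
qed

lemma N_nonneg: "a \<in> E \<Longrightarrow> 0 \<le> N a"
  using vnorm_nonneg by simp

lemma N_eq_0_iff: "a \<in> E \<Longrightarrow> N a = 0 \<longleftrightarrow> a = (\<lambda>i. 0)"
  using vnorm_eq_0_iff by simp

lemma N_scale: "a \<in> E \<Longrightarrow> N (\<lambda>i. c * a i) = \<bar>c\<bar> * N a"
  using vnorm_smult by simp

lemma N_triangle: "a \<in> E \<Longrightarrow> b \<in> E \<Longrightarrow> N (\<lambda>i. a i + b i) \<le> N a + N b"
  using vnorm_triangle by simp

lemma E_mono: "a \<in> E \<Longrightarrow> (\<And>i. 0 \<le> b i) \<Longrightarrow> (\<And>i. b i \<le> a i) \<Longrightarrow> b \<in> E"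
  and N_mono: "a \<in> E \<Longrightarrow> (\<And>i. 0 \<le> b i) \<Longrightarrow> (\<And>i. b i \<le> a i) \<Longrightarrow> N b \<le> N a"
  using solid [of b a] by (metis abs_of_nonneg order_trans)+

lemma abs_le_N:
  assumes "a \<in> E"
  shows "\<bar>a i\<bar> \<le> N a"
proof -
  let ?e = "\<lambda>j. if j = i then 1 else (0::real)"
  have "N (\<lambda>j. a i * ?e j) \<le> N a"
    using solid [of "\<lambda>j. a i * ?e j" a] assms by auto
  moreover have "N (\<lambda>j. a i * ?e j) = \<bar>a i\<bar>"
    using N_scale [of ?e "a i"] unit_vector [of i] by simp
  ultimately show ?thesis by simp
qed

lemma E_complete:
  assumes "\<And>n. s n \<in> E" "\<And>\<epsilon>. 0 < \<epsilon> \<Longrightarrow> \<exists>K. \<forall>m\<ge>K. \<forall>n\<ge>K. N (\<lambda>i. s m i - s n i) < \<epsilon>"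
  obtains l where "l \<in> E" "(\<lambda>n. N (\<lambda>i. s n i - l i)) \<longlonglongrightarrow> 0"
proof -
  have "\<exists>l\<in>E. (\<lambda>n. N (s n \<ominus>\<^bsub>function_space E N\<^esub> l)) \<longlonglongrightarrow> 0"
    using complete assms unfolding mcomplete_iff by (simp add: function_space_minus)
  then show ?thesis
    using that assms(1) by (auto simp: function_space_minus)
qed

end


lemma normed_space_absolute_sum:
  assumes "absolute_norm E N" and X: "\<And>i. normed_space (X i)"
  shows "normed_space (absolute_sum E N X)"
proof -
  interpret absolute_norm E N by fact
  interpret X: normed_space "X i" for i by (rule X)
  let ?S = "absolute_sum E N X"
  have add: "(\<lambda>i. x i \<oplus>\<^bsub>X i\<^esub> y i) \<in> carrier ?S" "vnorm ?S (x \<oplus>\<^bsub>?S\<^esub> y) \<le> vnorm ?S x + vnorm ?S y"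
    if "x \<in> carrier ?S" "y \<in> carrier ?S" for x y
  proof -
    let ?b = "\<lambda>i. vnorm (X i) (x i) + vnorm (X i) (y i)"
    have b: "?b \<in> E" using that E_add by auto
    have *: "vnorm (X i) (x i \<oplus>\<^bsub>X i\<^esub> y i) \<le> ?b i" "0 \<le> vnorm (X i) (x i \<oplus>\<^bsub>X i\<^esub> y i)" for i
      using that by (auto intro: X.vnorm_triangle X.vnorm_nonneg)
    show "(\<lambda>i. x i \<oplus>\<^bsub>X i\<^esub> y i) \<in> carrier ?S"
      using E_mono [OF b *(2,1)] that by auto
    have "vnorm ?S (x \<oplus>\<^bsub>?S\<^esub> y) \<le> N ?b"
      using N_mono [OF b *(2,1)] by simp
    also have "\<dots> \<le> vnorm ?S x + vnorm ?S y"
      using that N_triangle by simp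
    finally show "vnorm ?S (x \<oplus>\<^bsub>?S\<^esub> y) \<le> vnorm ?S x + vnorm ?S y" .
  qed
  have smult: "(\<lambda>i. c \<odot>\<^bsub>X i\<^esub> x i) \<in> carrier ?S" "vnorm ?S (c \<odot>\<^bsub>?S\<^esub> x) = \<bar>c\<bar> * vnorm ?S x"
    if "x \<in> carrier ?S" for c x
    using that E_scale N_scale by (auto simp: X.vnorm_smult X.smult_closed)
  have zero: "(\<lambda>i. \<zero>\<^bsub>X i\<^esub>) \<in> carrier ?S"
    by (simp add: X.vnorm_zero E_zero)
  have neg: "\<exists>y\<in>carrier ?S. y \<oplus>\<^bsub>?S\<^esub> x = \<zero>\<^bsub>?S\<^esub>" if "x \<in> carrier ?S" for x
  proof (intro bexI)
    have "(-1) \<odot>\<^bsub>X i\<^esub> x i \<oplus>\<^bsub>X i\<^esub> x i = \<zero>\<^bsub>X i\<^esub>" for i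
      using that X.smult_l_distr [of "-1" 1 "x i" i] X.smult_one [of "x i" i] X.smult_l_null [of "x i" i]
      by simp
    then show "(-1) \<odot>\<^bsub>?S\<^esub> x \<oplus>\<^bsub>?S\<^esub> x = \<zero>\<^bsub>?S\<^esub>"
      by simp
    show "(-1) \<odot>\<^bsub>?S\<^esub> x \<in> carrier ?S"
      using smult(1) [OF that] by simp
  qed
  have group: "abelian_group ?S"
    using add(1) zero neg
    by (intro abelian_groupI) (auto simp: X.M.a_ac)
  have module: "module real_ring ?S"
    using smult(1) X.smult_l_distr X.smult_r_distr X.smult_assoc1 X.smult_one
    by (intro moduleI cring_real_ring group) auto
  show ?thesis
  proof (intro normed_space.intro normed_space_axioms.intro module)
    fix x assume x: "x \<in> carrier ?S"
    show "0 \<le> vnorm ?S x" using x N_nonneg by simp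
    show "vnorm ?S x = 0 \<longleftrightarrow> x = \<zero>\<^bsub>?S\<^esub>"
      using x N_eq_0_iff by (auto simp: fun_eq_iff X.vnorm_eq_0_iff)
  qed (use add(2) smult(2) in auto)
qed

lemma absolute_sum_minus:
  assumes "absolute_norm E N" and X: "\<And>i. normed_space (X i)"
    and x: "x \<in> carrier (absolute_sum E N X)" and y: "y \<in> carrier (absolute_sum E N X)"
  shows "x \<ominus>\<^bsub>absolute_sum E N X\<^esub> y = (\<lambda>i. x i \<ominus>\<^bsub>X i\<^esub> y i)"
proof -
  let ?S = "absolute_sum E N X"
  interpret S: normed_space ?S by (rule normed_space_absolute_sum) fact+
  interpret X: normed_space "X i" for i by (rule X)
  have neg: "(-1) \<odot>\<^bsub>X i\<^esub> u = \<ominus>\<^bsub>X i\<^esub> u" if "u \<in> carrier (X i)" for i u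
    using X.smult_l_minus [of 1 u i] X.smult_one [of u i] that by simp
  have "\<ominus>\<^bsub>?S\<^esub> y = (-1) \<odot>\<^bsub>?S\<^esub> y"
    using S.smult_l_minus [of 1 y] S.smult_one [of y] y by simp
  then show ?thesis
    using y by (simp add: a_minus_def neg)
qed

text \<open>The absolute sum of Banach spaces is a Banach space.\<close>

theorem banach_space_absolute_sum:
  assumes "absolute_norm E N" and X: "\<And>i. banach_space (X i)"
  shows "banach_space (absolute_sum E N X)"
proof -
  let ?S = "absolute_sum E N X"
  interpret absolute_norm E N by fact
  interpret X: banach_space "X i" for i by (rule X)
  interpret S: normed_space ?S
    by (rule normed_space_absolute_sum) (fact, rule X.normed_space_axioms)
  have S_minus: "x \<ominus>\<^bsub>?S\<^esub> y = (\<lambda>i. x i \<ominus>\<^bsub>X i\<^esub> y i)" if "x \<in> carrier ?S" "y \<in> carrier ?S" for x y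
    by (rule absolute_sum_minus) (fact, rule X.normed_space_axioms, fact+)
  have "\<exists>l\<in>carrier ?S. (\<lambda>n. vnorm ?S (\<sigma> n \<ominus>\<^bsub>?S\<^esub> l)) \<longlonglongrightarrow> 0"
    if \<sigma>: "\<And>n. \<sigma> n \<in> carrier ?S"
      and Cauchy: "\<And>\<epsilon>. 0 < \<epsilon> \<Longrightarrow> \<exists>K. \<forall>m\<ge>K. \<forall>n\<ge>K. vnorm ?S (\<sigma> m \<ominus>\<^bsub>?S\<^esub> \<sigma> n) < \<epsilon>" for \<sigma>
  proof -
    define D where "D m n i = vnorm (X i) (\<sigma> m i \<ominus>\<^bsub>X i\<^esub> \<sigma> n i)" for m n i
    have \<sigma>X: "\<sigma> n i \<in> carrier (X i)" for n i
      using \<sigma> by simp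
    have D: "D m n \<in> E" "vnorm ?S (\<sigma> m \<ominus>\<^bsub>?S\<^esub> \<sigma> n) = N (D m n)" for m n
      using S.M.minus_closed [OF \<sigma> \<sigma>, of m n] S_minus [OF \<sigma> \<sigma>, of m n]
      by (auto simp: D_def [abs_def])
    have D_nonneg: "0 \<le> D m n i" for m n i
      unfolding D_def by (simp add: X.vnorm_nonneg \<sigma>X)
    have "\<exists>u\<in>carrier (X i). (\<lambda>n. vnorm (X i) (\<sigma> n i \<ominus>\<^bsub>X i\<^esub> u)) \<longlonglongrightarrow> 0" for i
    proof -
      have "\<exists>K. \<forall>m\<ge>K. \<forall>n\<ge>K. D m n i < \<epsilon>" if "0 < \<epsilon>" for \<epsilon>
      proof -
        obtain K where K: "\<forall>m\<ge>K. \<forall>n\<ge>K. N (D m n) < \<epsilon>"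
          using Cauchy [OF \<open>0 < \<epsilon>\<close>] D(2) by auto
        have "D m n i \<le> N (D m n)" for m n
          using abs_le_N [OF D(1), of m n i] by linarith
        with K show ?thesis by (meson order.strict_trans1)
      qed
      then show ?thesis
        using X.mcomplete_iff [THEN iffD1, OF X.complete, of i, THEN spec, of "\<lambda>n. \<sigma> n i"] \<sigma>X
        by (simp add: D_def)
    qed
    then obtain l where l: "\<And>i. l i \<in> carrier (X i)"
      "\<And>i. (\<lambda>n. vnorm (X i) (\<sigma> n i \<ominus>\<^bsub>X i\<^esub> l i)) \<longlonglongrightarrow> 0"
      by metis
    have "\<exists>K. \<forall>m\<ge>K. \<forall>n\<ge>K. N (D m n) < (1/2) ^ k" for k :: nat
      using Cauchy [of "(1/2) ^ k"] D(2) by simp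
    then obtain K where K: "\<And>k m n. K k \<le> m \<Longrightarrow> K k \<le> n \<Longrightarrow> N (D m n) < (1/2) ^ k"
      by metis
    define r where "r k = k + (\<Sum>j\<le>k. K j)" for k
    have r: "K k \<le> r m" if "k \<le> m" for k m
      unfolding r_def using that by (intro trans_le_add2 member_le_sum) auto
    have r_lim: "filterlim (\<lambda>m. r (k + m)) at_top sequentially" for k
      by (rule filterlim_at_top_mono [OF filterlim_ident]) (simp add: r_def)
    define s where "s k i = (\<Sum>j<k. D (r (Suc j)) (r j) i)" for k i
    have sE: "s k \<in> E" for k
      by (induction k) (auto simp: s_def [abs_def] E_zero intro!: E_add D)
    have s_diff: "N (\<lambda>i. s (k + m) i - s k i) \<le> (\<Sum>j<m. (1/2) ^ (k + j))" for k m
    proof (induction m)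
      case 0
      show ?case using N_eq_0_iff [OF E_zero] by simp
    next
      case (Suc m)
      have "(\<lambda>i. s (k + Suc m) i - s k i) = (\<lambda>i. (s (k + m) i - s k i) + D (r (Suc (k + m))) (r (k + m)) i)"
        by (simp add: s_def fun_eq_iff)
      then have "N (\<lambda>i. s (k + Suc m) i - s k i)
          \<le> N (\<lambda>i. s (k + m) i - s k i) + N (D (r (Suc (k + m))) (r (k + m)))"
        using N_triangle [OF E_minus [OF sE sE] D(1), of "k + m" k] by simp
      also have "\<dots> \<le> (\<Sum>j<m. (1/2) ^ (k + j)) + (1/2) ^ (k + m)"
        using Suc K [of "k + m" "r (Suc (k + m))" "r (k + m)"] r by (intro add_mono) (auto intro: less_imp_le)
      finally show ?case by simp
    qed
    have geo: "(\<Sum>j<m. (1/2) ^ (k + j)) \<le> 2 * (1/2::real) ^ k" for k m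
    proof -
      have "(\<Sum>j<m. (1/2::real) ^ j) \<le> 2"
        by (simp add: sum_gp_strict)
      then have "(1/2) ^ k * (\<Sum>j<m. (1/2::real) ^ j) \<le> (1/2) ^ k * 2"
        by (intro mult_left_mono) auto
      then show ?thesis
        by (simp add: power_add sum_distrib_left mult.commute)
    qed
    have s_le: "N (\<lambda>i. s n i - s m i) \<le> 2 * (1/2) ^ m" if "m \<le> n" for m n
      using order_trans [OF s_diff geo, of m "n - m"] that by simp
    have N_commute: "N (\<lambda>i. a i - b i) = N (\<lambda>i. b i - a i)" if "a \<in> E" "b \<in> E" for a b
      using N_scale [OF E_minus [OF that], of "-1"] by simp
    have "\<exists>K. \<forall>m\<ge>K. \<forall>n\<ge>K. N (\<lambda>i. s m i - s n i) < \<epsilon>" if "0 < \<epsilon>" for \<epsilon>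
    proof -
      obtain K where K: "(1/2) ^ K < \<epsilon> / 2"
        using real_arch_pow_inv [of "\<epsilon> / 2" "1/2"] \<open>0 < \<epsilon>\<close> by auto
      have *: "N (\<lambda>i. s n i - s m i) < \<epsilon>" if "K \<le> m" "m \<le> n" for m n
        using s_le [OF that(2)] K power_decreasing [OF that(1), of "1/2::real"] by linarith
      have "N (\<lambda>i. s m i - s n i) < \<epsilon>" if "K \<le> m" "K \<le> n" for m n
        using * [of m n] * [of n m] N_commute [OF sE sE, of m n] that by (cases "m \<le> n") auto
      then show ?thesis by blast
    qed
    then obtain t where t: "t \<in> E" "(\<lambda>n. N (\<lambda>i. s n i - t i)) \<longlonglongrightarrow> 0"
      using E_complete [of s] sE by blast
    have t_lim: "(\<lambda>n. s n i) \<longlonglongrightarrow> t i" for i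
    proof (rule LIM_zero_cancel, rule Lim_null_comparison [OF _ t(2)])
      show "\<forall>\<^sub>F n in sequentially. norm (s n i - t i) \<le> N (\<lambda>i. s n i - t i)"
        using abs_le_N [OF E_minus [OF sE t(1)], of _ i] by simp
    qed
    have s_mono: "s k i \<le> s n i" if "k \<le> n" for k n i
      unfolding s_def using that D_nonneg by (intro sum_mono2) auto
    have s_le_t: "s k i \<le> t i" for k i
      using t_lim [of i] by (rule LIMSEQ_le_const) (use s_mono in blast)
    have D_le: "D (r (k + m)) (r k) i \<le> s (k + m) i - s k i" for k m i
    proof (induction m)
      case 0
      show ?case
        using X.minus_eq_zero_iff [of "\<sigma> (r k) i" i "\<sigma> (r k) i"] \<sigma>X by (simp add: D_def X.vnorm_zero)
    next
      case (Suc m)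
      have "D (r (Suc (k + m))) (r k) i \<le> D (r (Suc (k + m))) (r (k + m)) i + D (r (k + m)) (r k) i"
        unfolding D_def by (intro X.vnorm_minus_triangle \<sigma>X)
      with Suc show ?case by (simp add: s_def)
    qed
    define c where "c n i = vnorm (X i) (\<sigma> n i \<ominus>\<^bsub>X i\<^esub> l i)" for n i
    have c_nonneg: "0 \<le> c n i" for n i
      unfolding c_def by (simp add: X.vnorm_nonneg \<sigma>X l)
    have c_triangle: "c m i \<le> D m n i + c n i" for m n i
      unfolding c_def D_def by (intro X.vnorm_minus_triangle \<sigma>X l)
    have c_lim: "(\<lambda>n. c n i) \<longlonglongrightarrow> 0" for i
      unfolding c_def by (rule l)
    have c_le: "c (r k) i \<le> t i - s k i" for k i
    proof (rule LIMSEQ_le_const)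
      have "(\<lambda>m. c (r (k + m)) i) \<longlonglongrightarrow> 0"
        by (rule filterlim_compose [OF c_lim r_lim])
      then show "(\<lambda>m. (t i - s k i) + c (r (k + m)) i) \<longlonglongrightarrow> t i - s k i"
        using tendsto_add [OF tendsto_const] by fastforce
      have "c (r k) i \<le> (t i - s k i) + c (r (k + m)) i" for m
      proof -
        have "D (r k) (r (k + m)) i = D (r (k + m)) (r k) i"
          unfolding D_def by (intro X.vnorm_minus_commute \<sigma>X)
        then show ?thesis
          using c_triangle [of "r k" i "r (k + m)"] D_le [of k m i] s_le_t [of "k + m" i] by simp
      qed
      then show "\<exists>M. \<forall>m\<ge>M. c (r k) i \<le> (t i - s k i) + c (r (k + m)) i"
        by blast
    qed
    have cE: "c (r k) \<in> E" "N (c (r k)) \<le> N (\<lambda>i. s k i - t i)" for k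
      using E_mono [OF E_minus [OF t(1) sE] c_nonneg c_le] N_mono [OF E_minus [OF t(1) sE] c_nonneg c_le]
        N_commute [OF sE t(1)] by auto
    have l_S: "l \<in> carrier ?S"
    proof -
      have le: "vnorm (X i) (l i) \<le> c (r 0) i + vnorm (X i) (\<sigma> (r 0) i)" for i
        using X.vnorm_minus_triangle [of "l i" i "\<sigma> (r 0) i" "\<zero>\<^bsub>X i\<^esub>"]
          X.vnorm_minus_commute [of "l i" i "\<sigma> (r 0) i"] l(1) \<sigma>X
          X.M.minus_equality [where x = "\<zero>\<^bsub>X i\<^esub>" and y = "\<zero>\<^bsub>X i\<^esub>"]
        by (simp add: c_def a_minus_def)
      have "(\<lambda>i. c (r 0) i + vnorm (X i) (\<sigma> (r 0) i)) \<in> E"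
        using E_add [OF cE(1)] \<sigma> by simp
      then have "(\<lambda>i. vnorm (X i) (l i)) \<in> E"
        by (rule E_mono) (rule X.vnorm_nonneg [OF l(1)], rule le)
      then show ?thesis by (simp add: l(1))
    qed
    have c_eq: "vnorm ?S (\<sigma> n \<ominus>\<^bsub>?S\<^esub> l) = N (c n)" for n
      using S_minus [OF \<sigma> l_S] by (simp add: c_def [abs_def])
    have "(\<lambda>n. N (c n)) \<longlonglongrightarrow> 0"
    proof (rule LIMSEQ_I)
      fix \<epsilon> :: real assume "0 < \<epsilon>"
      obtain k1 where k1: "\<And>k. k1 \<le> k \<Longrightarrow> N (\<lambda>i. s k i - t i) < \<epsilon> / 2"
        using LIMSEQ_D [OF t(2), of "\<epsilon> / 2"] \<open>0 < \<epsilon>\<close> N_nonneg [OF E_minus [OF sE t(1)]] by auto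
      obtain k2 where k2: "(1/2) ^ k2 < \<epsilon> / 2"
        using real_arch_pow_inv [of "\<epsilon> / 2" "1/2"] \<open>0 < \<epsilon>\<close> by auto
      define k where "k = max k1 k2"
      have k: "N (c (r k)) < \<epsilon> / 2" "(1/2) ^ k < \<epsilon> / 2"
        using k1 [of k] cE(2) [of k] k2 power_decreasing [of k2 k "1/2::real"]
        unfolding k_def by (force, linarith)
      have "norm (N (c n) - 0) < \<epsilon>" if "K k \<le> n" for n
      proof -
        have "c n \<in> E" "N (c n) \<le> N (\<lambda>i. D n (r k) i + c (r k) i)"
          using E_mono [OF E_add [OF D(1) cE(1)] c_nonneg c_triangle]
            N_mono [OF E_add [OF D(1) cE(1)] c_nonneg c_triangle] by auto
        then show ?thesis
          using N_triangle [OF D(1) cE(1), of n "r k" k] K [OF that r [OF order_refl]] k N_nonneg [of "c n"]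
          by simp
      qed
      then show "\<exists>M. \<forall>n\<ge>M. norm (N (c n) - 0) < \<epsilon>" by blast
    qed
    then show ?thesis
      using l_S c_eq by auto
  qed
  then have "Metric_space.mcomplete (carrier ?S) (vdist ?S)"
    unfolding S.mcomplete_iff by blast
  then show ?thesis
    by (intro banach_space.intro banach_space_axioms.intro S.normed_space_axioms)
qed

end

theory Submission
  imports Defs
begin

text \<open>
  Both properties say that every \<open>x\<close> on the unit sphere has a companion \<open>y\<close> such that the norms of
  \<open>y\<close> and of \<open>x \<plusminus> y\<close> lie between prescribed bounds. By homogeneity, companions exist for all vectors
  \<open>x\<close> if the bounds are multiplied by the norm of \<open>x\<close>. In the absolute sum, choose a companion in each
  coordinate: the bounds hold coordinatewise with the same constants, so they pass to the norm of \<open>E\<close>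
  by monotonicity.
\<close>

text \<open>The set \<open>A\<close> is the unit sphere, where both properties are stated, or the
  whole carrier, which the coordinates of a unit vector of the sum require, since their norms need
  not be 1. All bounds are two-sided because the upper ones are what keeps the tuples of norms in
  \<open>E\<close>.\<close>

definition companion_on :: "'a set \<Rightarrow> ('a, 'b) normed_scheme \<Rightarrow> real \<Rightarrow> real \<Rightarrow> real \<Rightarrow> real \<Rightarrow> bool"
  where "companion_on A V \<alpha> \<beta> a b \<longleftrightarrow> (\<forall>x\<in>A. \<exists>y\<in>carrier V.
    vnorm V y \<in> {\<alpha> * vnorm V x..\<beta> * vnorm V x} \<and>
    vnorm V (x \<oplus>\<^bsub>V\<^esub> y) \<in> {a * vnorm V x..b * vnorm V x} \<and>
    vnorm V (x \<ominus>\<^bsub>V\<^esub> y) \<in> {a * vnorm V x..b * vnorm V x})"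

context normed_space
begin

lemma smult_minus_distr:
  assumes "x \<in> carrier V" "y \<in> carrier V"
  shows "c \<odot>\<^bsub>V\<^esub> (x \<ominus>\<^bsub>V\<^esub> y) = c \<odot>\<^bsub>V\<^esub> x \<ominus>\<^bsub>V\<^esub> c \<odot>\<^bsub>V\<^esub> y"
  using assms smult_r_distr [of c x "\<ominus>\<^bsub>V\<^esub> y"] smult_r_minus [of c y] by (simp add: a_minus_def)

lemma uminus_zero: "\<ominus>\<^bsub>V\<^esub> \<zero>\<^bsub>V\<^esub> = \<zero>\<^bsub>V\<^esub>"
  by (rule M.minus_equality) simp_all

lemma vnorm_minus_le:
  assumes "x \<in> carrier V" "y \<in> carrier V"
  shows "vnorm V (x \<ominus>\<^bsub>V\<^esub> y) \<le> vnorm V x + vnorm V y"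
  using vnorm_minus_triangle [of x "\<zero>\<^bsub>V\<^esub>" y] vnorm_minus_commute [of "\<zero>\<^bsub>V\<^esub>" y] assms
  by (simp add: a_minus_def uminus_zero)

lemma companion_on_unit_sphere_iff:
  "companion_on (unit_sphere V) V \<alpha> \<beta> a b \<longleftrightarrow> (\<forall>x\<in>unit_sphere V. \<exists>y\<in>carrier V.
    vnorm V y \<in> {\<alpha>..\<beta>} \<and> vnorm V (x \<oplus>\<^bsub>V\<^esub> y) \<in> {a..b} \<and> vnorm V (x \<ominus>\<^bsub>V\<^esub> y) \<in> {a..b})"
  unfolding companion_on_def by (rule ball_cong [OF refl]) (simp add: unit_sphere_def)

text \<open>The conditions are homogeneous: if \<open>z\<close> is a companion of the normalised
  vector, then \<open>vnorm V x\<close> times \<open>z\<close> is one of \<open>x\<close>.\<close>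

lemma companion_on_carrier_iff:
  "companion_on (carrier V) V \<alpha> \<beta> a b \<longleftrightarrow> companion_on (unit_sphere V) V \<alpha> \<beta> a b"
proof
  show "companion_on (unit_sphere V) V \<alpha> \<beta> a b" if "companion_on (carrier V) V \<alpha> \<beta> a b"
    using that unfolding companion_on_def unit_sphere_def by blast
next
  assume sphere: "companion_on (unit_sphere V) V \<alpha> \<beta> a b"
  show "companion_on (carrier V) V \<alpha> \<beta> a b"
    unfolding companion_on_def
  proof
    fix x assume x: "x \<in> carrier V"
    let ?r = "vnorm V x"
    let ?P = "\<lambda>y. vnorm V y \<in> {\<alpha> * ?r..\<beta> * ?r} \<and> vnorm V (x \<oplus>\<^bsub>V\<^esub> y) \<in> {a * ?r..b * ?r} \<and>
      vnorm V (x \<ominus>\<^bsub>V\<^esub> y) \<in> {a * ?r..b * ?r}"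
    show "\<exists>y\<in>carrier V. ?P y"
    proof (cases "?r = 0")
      \<comment> \<open>The zero vector cannot be normalised, but here all bounds collapse to 0 and
        the zero vector is its own companion.\<close>
      case True
      then have "x = \<zero>\<^bsub>V\<^esub>" using x vnorm_eq_0_iff by simp
      then have "?P \<zero>\<^bsub>V\<^esub>" by (simp add: vnorm_zero a_minus_def uminus_zero)
      then show ?thesis by blast
    next
      case False
      with x vnorm_nonneg have r: "0 < ?r" by (simp add: less_le)
      define u where "u = (1 / ?r) \<odot>\<^bsub>V\<^esub> x"
      have u: "u \<in> carrier V" "vnorm V u = 1" "x = ?r \<odot>\<^bsub>V\<^esub> u"
        using x r vnorm_smult [of x "1 / ?r"] smult_assoc1 [of ?r "1 / ?r" x] smult_one [of x]
        by (simp_all add: u_def)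
      from u(1,2) have "u \<in> unit_sphere V" by (simp add: unit_sphere_def)
      then obtain z where z: "z \<in> carrier V" "vnorm V z \<in> {\<alpha>..\<beta>}"
        "vnorm V (u \<oplus>\<^bsub>V\<^esub> z) \<in> {a..b}" "vnorm V (u \<ominus>\<^bsub>V\<^esub> z) \<in> {a..b}"
        using sphere unfolding companion_on_unit_sphere_iff by blast
      have "x \<oplus>\<^bsub>V\<^esub> ?r \<odot>\<^bsub>V\<^esub> z = ?r \<odot>\<^bsub>V\<^esub> (u \<oplus>\<^bsub>V\<^esub> z)" "x \<ominus>\<^bsub>V\<^esub> ?r \<odot>\<^bsub>V\<^esub> z = ?r \<odot>\<^bsub>V\<^esub> (u \<ominus>\<^bsub>V\<^esub> z)"
        using u z smult_r_distr [of ?r u z] smult_minus_distr [of u z ?r] by simp_all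
      then have "?P (?r \<odot>\<^bsub>V\<^esub> z)"
        using u(1) z r by (simp add: vnorm_smult mult.commute)
      then show ?thesis using z(1) by (intro bexI [of _ "?r \<odot>\<^bsub>V\<^esub> z"]) simp_all
    qed
  qed
qed

text \<open>The upper bound 2 costs nothing by the triangle inequality. Restricting \<epsilon> to
  values below 1 loses nothing, as smaller \<epsilon> give stronger conditions, and it keeps 2 -
  \<epsilon> nonnegative for use in the sum.\<close>

lemma locally_octahedral_iff:
  "locally_octahedral V \<longleftrightarrow> (\<forall>\<epsilon>\<in>{0<..<1}. companion_on (carrier V) V 1 1 (2 - \<epsilon>) 2)"
proof
  assume octa: "locally_octahedral V"
  have "companion_on (unit_sphere V) V 1 1 (2 - \<epsilon>) 2" if "0 < \<epsilon>" for \<epsilon>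
    unfolding companion_on_unit_sphere_iff
  proof
    fix x assume x: "x \<in> unit_sphere V"
    then obtain y where y: "y \<in> unit_sphere V"
      "2 - \<epsilon> \<le> vnorm V (x \<oplus>\<^bsub>V\<^esub> y)" "2 - \<epsilon> \<le> vnorm V (x \<ominus>\<^bsub>V\<^esub> y)"
      using octa \<open>0 < \<epsilon>\<close> unfolding locally_octahedral_def by blast
    with x show "\<exists>y\<in>carrier V. vnorm V y \<in> {1..1} \<and>
      vnorm V (x \<oplus>\<^bsub>V\<^esub> y) \<in> {2 - \<epsilon>..2} \<and>
      vnorm V (x \<ominus>\<^bsub>V\<^esub> y) \<in> {2 - \<epsilon>..2}"
      using vnorm_triangle [of x y] vnorm_minus_le [of x y]
      by (intro bexI [of _ y]) (auto simp: unit_sphere_def)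
  qed
  then show "\<forall>\<epsilon>\<in>{0<..<1}. companion_on (carrier V) V 1 1 (2 - \<epsilon>) 2"
    by (simp add: companion_on_carrier_iff)
next
  assume comp: "\<forall>\<epsilon>\<in>{0<..<1}. companion_on (carrier V) V 1 1 (2 - \<epsilon>) 2"
  show "locally_octahedral V"
    unfolding locally_octahedral_def
  proof (intro ballI allI impI)
    fix x and \<epsilon> :: real assume x: "x \<in> unit_sphere V" and \<epsilon>: "0 < \<epsilon>"
    \<comment> \<open>The minimum with 1/2 brings an arbitrarily large \<epsilon> into the open
      interval from 0 to 1.\<close>
    have "companion_on (unit_sphere V) V 1 1 (2 - min \<epsilon> (1/2)) 2"
      using comp \<epsilon> by (simp add: companion_on_carrier_iff)
    then obtain y where y: "y \<in> carrier V" "vnorm V y \<in> {1..1}"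
      "2 - min \<epsilon> (1/2) \<le> vnorm V (x \<oplus>\<^bsub>V\<^esub> y)" "2 - min \<epsilon> (1/2) \<le> vnorm V (x \<ominus>\<^bsub>V\<^esub> y)"
      using x unfolding companion_on_unit_sphere_iff atLeastAtMost_iff by blast
    then have "y \<in> unit_sphere V" by (simp add: unit_sphere_def)
    with y show "\<exists>y\<in>unit_sphere V. 2 - \<epsilon> \<le> vnorm V (x \<oplus>\<^bsub>V\<^esub> y) \<and> 2 - \<epsilon> \<le> vnorm V (x \<ominus>\<^bsub>V\<^esub> y)"
      by (intro bexI [of _ y]) auto
  qed
qed

text \<open>This trades sequences for a condition with \<epsilon>: one term far enough out in the
  sequence is a companion, and conversely companions for a null sequence of \<epsilon> form the
  required sequence. The bound 1 on the norm of the companion, without \<epsilon>, encodes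
  membership in the unit ball.\<close>

lemma locally_almost_square_iff:
  "locally_almost_square V \<longleftrightarrow>
    (\<forall>\<epsilon>\<in>{0<..<1}. companion_on (carrier V) V (1 - \<epsilon>) 1 (1 - \<epsilon>) (1 + \<epsilon>))"
proof
  assume lasq: "locally_almost_square V"
  have "companion_on (unit_sphere V) V (1 - \<epsilon>) 1 (1 - \<epsilon>) (1 + \<epsilon>)" if "0 < \<epsilon>" for \<epsilon>
    unfolding companion_on_unit_sphere_iff
  proof
    fix x assume x: "x \<in> unit_sphere V"
    then obtain y where y: "\<And>n. y n \<in> unit_ball V"
      and lim: "(\<lambda>n. vnorm V (x \<oplus>\<^bsub>V\<^esub> y n)) \<longlonglongrightarrow> 1" "(\<lambda>n. vnorm V (x \<ominus>\<^bsub>V\<^esub> y n)) \<longlonglongrightarrow> 1"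
        "(\<lambda>n. vnorm V (y n)) \<longlonglongrightarrow> 1"
      using lasq unfolding locally_almost_square_def by blast
    have "\<forall>\<^sub>F n in sequentially. \<bar>vnorm V (x \<oplus>\<^bsub>V\<^esub> y n) - 1\<bar> < \<epsilon> \<and>
        \<bar>vnorm V (x \<ominus>\<^bsub>V\<^esub> y n) - 1\<bar> < \<epsilon> \<and> \<bar>vnorm V (y n) - 1\<bar> < \<epsilon>"
      using lim [THEN tendstoD, OF \<open>0 < \<epsilon>\<close>] by (intro eventually_conj) (simp_all add: dist_real_def)
    \<comment> \<open>A single index has to serve all three limits.\<close>
    from eventually_happens' [OF sequentially_bot this] obtain n where "\<bar>vnorm V (x \<oplus>\<^bsub>V\<^esub> y n) - 1\<bar> < \<epsilon> \<and>
        \<bar>vnorm V (x \<ominus>\<^bsub>V\<^esub> y n) - 1\<bar> < \<epsilon> \<and> \<bar>vnorm V (y n) - 1\<bar> < \<epsilon>"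
      by blast
    then show "\<exists>y\<in>carrier V. vnorm V y \<in> {1 - \<epsilon>..1} \<and>
      vnorm V (x \<oplus>\<^bsub>V\<^esub> y) \<in> {1 - \<epsilon>..1 + \<epsilon>} \<and>
      vnorm V (x \<ominus>\<^bsub>V\<^esub> y) \<in> {1 - \<epsilon>..1 + \<epsilon>}"
      using y [of n] by (intro bexI [of _ "y n"]) (auto simp: unit_ball_def)
  qed
  then show "\<forall>\<epsilon>\<in>{0<..<1}. companion_on (carrier V) V (1 - \<epsilon>) 1 (1 - \<epsilon>) (1 + \<epsilon>)"
    by (simp add: companion_on_carrier_iff)
next
  assume comp: "\<forall>\<epsilon>\<in>{0<..<1}. companion_on (carrier V) V (1 - \<epsilon>) 1 (1 - \<epsilon>) (1 + \<epsilon>)"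
  \<comment> \<open>The denominator starts at 2, so that already the first value is strictly below
    1.\<close>
  define \<epsilon> where "\<epsilon> n = 1 / real (Suc (Suc n))" for n
  have \<epsilon>: "\<epsilon> n \<in> {0<..<1}" for n
    by (simp add: \<epsilon>_def)
  have \<epsilon>_lim: "\<epsilon> \<longlonglongrightarrow> 0"
    using LIMSEQ_Suc [OF LIMSEQ_inverse_real_of_nat] by (simp add: \<epsilon>_def [abs_def] inverse_eq_divide)
  have bounds: "(\<lambda>n. 1 - \<epsilon> n) \<longlonglongrightarrow> 1" "(\<lambda>n. 1 + \<epsilon> n) \<longlonglongrightarrow> 1"
    using tendsto_diff [OF tendsto_const \<epsilon>_lim, of 1] tendsto_add [OF tendsto_const \<epsilon>_lim, of 1]
    by simp_all
  show "locally_almost_square V"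
    unfolding locally_almost_square_def
  proof
    fix x assume x: "x \<in> unit_sphere V"
    \<comment> \<open>The bound 1 on the norm of \<open>y\<close> survives in
      \<open>unit_ball V\<close>; in the interval it is relaxed to \<open>1 + \<epsilon> n\<close>,
      so that one sandwich argument covers all three limits.\<close>
    have "\<exists>y\<in>unit_ball V. vnorm V y \<in> {1 - \<epsilon> n..1 + \<epsilon> n} \<and>
      vnorm V (x \<oplus>\<^bsub>V\<^esub> y) \<in> {1 - \<epsilon> n..1 + \<epsilon> n} \<and> vnorm V (x \<ominus>\<^bsub>V\<^esub> y) \<in> {1 - \<epsilon> n..1 + \<epsilon> n}" for n
    proof -
      have "companion_on (unit_sphere V) V (1 - \<epsilon> n) 1 (1 - \<epsilon> n) (1 + \<epsilon> n)"
        using comp \<epsilon> companion_on_carrier_iff by blast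
      then obtain y where "y \<in> carrier V" "vnorm V y \<in> {1 - \<epsilon> n..1}"
        "vnorm V (x \<oplus>\<^bsub>V\<^esub> y) \<in> {1 - \<epsilon> n..1 + \<epsilon> n}" "vnorm V (x \<ominus>\<^bsub>V\<^esub> y) \<in> {1 - \<epsilon> n..1 + \<epsilon> n}"
        using x unfolding companion_on_unit_sphere_iff by blast
      then show ?thesis
        using \<epsilon> [of n] by (intro bexI [of _ y]) (auto simp: unit_ball_def)
    qed
    then obtain y where y: "\<And>n. y n \<in> unit_ball V" "\<And>n. vnorm V (y n) \<in> {1 - \<epsilon> n..1 + \<epsilon> n}"
      "\<And>n. vnorm V (x \<oplus>\<^bsub>V\<^esub> y n) \<in> {1 - \<epsilon> n..1 + \<epsilon> n}" "\<And>n. vnorm V (x \<ominus>\<^bsub>V\<^esub> y n) \<in> {1 - \<epsilon> n..1 + \<epsilon> n}"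
      by metis
    have lim: "f \<longlonglongrightarrow> 1" if "\<And>n. f n \<in> {1 - \<epsilon> n..1 + \<epsilon> n}" for f
      using that by (intro tendsto_sandwich [OF _ _ bounds] always_eventually) auto
    show "\<exists>y. (\<forall>n. y n \<in> unit_ball V) \<and> (\<lambda>n. vnorm V (x \<oplus>\<^bsub>V\<^esub> y n)) \<longlonglongrightarrow> 1 \<and>
      (\<lambda>n. vnorm V (x \<ominus>\<^bsub>V\<^esub> y n)) \<longlonglongrightarrow> 1 \<and> (\<lambda>n. vnorm V (y n)) \<longlonglongrightarrow> 1"
      by (intro exI [of _ y] conjI allI lim y)
  qed
qed

end

text \<open>The upper bound puts \<open>g\<close> into \<open>E\<close> by solidity, and the norm
  estimates are monotonicity and homogeneity of \<open>N\<close>. Since solidity compares absolute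
  values, the signs matter: \<open>0 \<le> a\<close> makes \<open>a * f i\<close>, and hence
  \<open>g i\<close>, nonnegative.\<close>

lemma (in absolute_norm) N_between:
  assumes f: "f \<in> E" "\<And>i. 0 \<le> f i" and ab: "0 \<le> a" "0 \<le> b"
    and g: "\<And>i. g i \<in> {a * f i..b * f i}"
  shows "g \<in> E" "N g \<in> {a * N f..b * N f}"
proof -
  have af: "0 \<le> a * f i" for i
    using f(2) ab(1) by simp
  have le: "a * f i \<le> g i" "g i \<le> b * f i" for i
    using g by auto
  have g0: "0 \<le> g i" for i
    using af le(1) by (rule order_trans)
  show E: "g \<in> E"
    using E_scale [OF f(1)] g0 le(2) by (rule E_mono)
  have "N (\<lambda>i. a * f i) \<le> N g"
    using E af le(1) by (rule N_mono)
  moreover have "N g \<le> N (\<lambda>i. b * f i)"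
    using E_scale [OF f(1)] g0 le(2) by (rule N_mono)
  ultimately show "N g \<in> {a * N f..b * N f}"
    using N_scale [OF f(1)] ab by simp
qed

text \<open>The constants do not depend on \<open>i\<close>, so \<open>N_between\<close> applies to
  the coordinatewise norms of \<open>y\<close> and of the sum and difference of \<open>x\<close> and
  \<open>y\<close>, each time compared with those of \<open>x\<close>.\<close>

lemma companion_on_absolute_sum:
  assumes "absolute_norm E N" and X: "\<And>i. normed_space (X i)"
    and nonneg: "0 \<le> \<alpha>" "0 \<le> \<beta>" "0 \<le> a" "0 \<le> b"
    and comp: "\<And>i. companion_on (carrier (X i)) (X i) \<alpha> \<beta> a b"
  shows "companion_on (carrier (absolute_sum E N X)) (absolute_sum E N X) \<alpha> \<beta> a b"
  unfolding companion_on_def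
proof
  interpret absolute_norm E N by fact
  let ?S = "absolute_sum E N X"
  fix x assume x: "x \<in> carrier ?S"
  define f where "f i = vnorm (X i) (x i)" for i
  have xi: "x i \<in> carrier (X i)" for i
    using x by simp
  have f: "f \<in> E" "0 \<le> f i" "N f = vnorm ?S x" for i
    using x normed_space.vnorm_nonneg [OF X xi] by (simp_all add: f_def [abs_def])
  have "\<exists>y\<in>carrier (X i). vnorm (X i) y \<in> {\<alpha> * f i..\<beta> * f i} \<and>
    vnorm (X i) (x i \<oplus>\<^bsub>X i\<^esub> y) \<in> {a * f i..b * f i} \<and>
    vnorm (X i) (x i \<ominus>\<^bsub>X i\<^esub> y) \<in> {a * f i..b * f i}" for i
    using comp [of i] xi unfolding companion_on_def f_def by blast
  then obtain y where y: "\<And>i. y i \<in> carrier (X i)"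
    and norm: "\<And>i. vnorm (X i) (y i) \<in> {\<alpha> * f i..\<beta> * f i}"
    "\<And>i. vnorm (X i) (x i \<oplus>\<^bsub>X i\<^esub> y i) \<in> {a * f i..b * f i}"
    "\<And>i. vnorm (X i) (x i \<ominus>\<^bsub>X i\<^esub> y i) \<in> {a * f i..b * f i}"
    by metis
  \<comment> \<open>Membership of the chosen \<open>y\<close> in the sum is not automatic; it comes
    from the upper bound \<open>\<beta> * f i\<close>.\<close>
  have yS: "y \<in> carrier ?S"
    using y N_between(1) [OF f(1,2) nonneg(1,2) norm(1)] by simp
  \<comment> \<open>Subtraction in the sum is defined through additive inverses in its carrier, so
    it is known to be coordinatewise only once \<open>y\<close> lies there.\<close>
  have minus: "x \<ominus>\<^bsub>?S\<^esub> y = (\<lambda>i. x i \<ominus>\<^bsub>X i\<^esub> y i)"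
    using absolute_sum_minus [OF assms(1) X x yS] .
  show "\<exists>y\<in>carrier ?S. vnorm ?S y \<in> {\<alpha> * vnorm ?S x..\<beta> * vnorm ?S x} \<and>
    vnorm ?S (x \<oplus>\<^bsub>?S\<^esub> y) \<in> {a * vnorm ?S x..b * vnorm ?S x} \<and>
    vnorm ?S (x \<ominus>\<^bsub>?S\<^esub> y) \<in> {a * vnorm ?S x..b * vnorm ?S x}"
    using N_between(2) [OF f(1,2) nonneg(1,2) norm(1)] N_between(2) [OF f(1,2) nonneg(3,4) norm(2)]
      N_between(2) [OF f(1,2) nonneg(3,4) norm(3)] yS
    unfolding f(3) by (intro bexI [OF _ yS]) (simp add: minus)
qed

theorem proposition5p3:
  fixes E :: "('i \<Rightarrow> real) set" and N :: "('i \<Rightarrow> real) \<Rightarrow> real"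
    and X :: "'i \<Rightarrow> 'a normed"
  assumes "absolute_norm E N"
    and "\<And>i. banach_space (X i)"
  shows "((\<forall>i. locally_octahedral (X i)) \<longrightarrow> locally_octahedral (absolute_sum E N X)) \<and>
         ((\<forall>i. locally_almost_square (X i)) \<longrightarrow> locally_almost_square (absolute_sum E N X))"
proof -
  have X: "normed_space (X i)" for i
    using assms(2) by (rule banach_space.axioms)
  have S: "normed_space (absolute_sum E N X)"
    using assms(1) X by (rule normed_space_absolute_sum)
  \<comment> \<open>For each fixed \<epsilon> between 0 and 1, the constants in both
    characterisations are nonnegative and common to all \<open>i\<close>.\<close>
  show ?thesis
    using companion_on_absolute_sum [OF assms(1) X]
    by (simp add: normed_space.locally_octahedral_iff [OF X] normed_space.locally_octahedral_iff [OF S]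
        normed_space.locally_almost_square_iff [OF X] normed_space.locally_almost_square_iff [OF S])
qed

end
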